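(* (1) If $G$ is any graph and $T$ is a tree with $k$ edges, then $\mathrm{ex}^*(G,T)<(2k-1)|V(G)|$. (2) If $G$ is $K_3$-free then $\mathrm{ex}^*(G,P_3)\le|V(G)|$. (3) If $G$ is $\{K_3,K_{2,3}\}$-free then $\mathrm{ex}^*(G,P_4)\le\frac{3}{2}|V(G)|$. (4) If $r\ge 3$ and $T$ is a tree with $k$ edges having a vertex $x_0$ adjacent to $\ell>\frac{3}{4}k+\frac{r-3}{2}$ leaves of $T$, then every $K_{2,r}$-free graph $G$ satisfies $\mathrm{ex}^*(G,T)\le\frac{k-1}{2}|V(G)|$.
   Context: $P_k$ denotes the path with $k$ edges. A graph is $F$-free if it has no subgraph isomorphic to $F$. A proper edge coloring assigns colors to edges so that edges sharing a vertex get different colors; a subgraph is rainbow if its edges have distinct colors. For graphs $G,F$, $\mathrm{ex}^*(G,F)$ is the maximum of $e(H)$ over subgraphs $H\subseteq G$ admitting a proper edge coloring with no rainbow subgraph isomorphic to $F$. *)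

theory Defs
  imports Complex_Main
begin

datatype 'a sgraph = SGraph (verts: "'a set") (edges: "'a set set")

text \<open>Finite simple graphs. The graph without vertices is allowed.\<close>

definition simple_graph :: "'a sgraph \<Rightarrow> bool" where
  "simple_graph G \<longleftrightarrow> finite (verts G) \<and> (\<forall>e\<in>edges G. e \<subseteq> verts G \<and> card e = 2)"

definition subgraph :: "'a sgraph \<Rightarrow> 'a sgraph \<Rightarrow> bool" where
  "subgraph H G \<longleftrightarrow> simple_graph H \<and> verts H \<subseteq> verts G \<and> edges H \<subseteq> edges G"

definition isomorphic :: "'a sgraph \<Rightarrow> 'b sgraph \<Rightarrow> bool" where
  "isomorphic F G \<longleftrightarrow>
     (\<exists>f. bij_betw f (verts F) (verts G) \<and> edges G = (\<lambda>e. f ` e) ` edges F)"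

definition free_of :: "'a sgraph \<Rightarrow> 'b sgraph \<Rightarrow> bool" where
  "free_of G F \<longleftrightarrow> \<not> (\<exists>S. subgraph S G \<and> isomorphic F S)"

text \<open>\<open>path_graph k\<close> has \<open>k\<close> edges, hence \<open>k + 1\<close> vertices.\<close>

definition path_graph :: "nat \<Rightarrow> nat sgraph" where
  "path_graph k = SGraph {..k} {{i, Suc i} | i. i < k}"

text \<open>\<open>cycle_graph n\<close> is only meant for \<open>n \<ge> 3\<close>.\<close>

definition cycle_graph :: "nat \<Rightarrow> nat sgraph" where
  "cycle_graph n = SGraph {..<n} {{i, Suc i mod n} | i. i < n}"

definition complete_graph :: "nat \<Rightarrow> nat sgraph" where
  "complete_graph n = SGraph {..<n} {{i, j} | i j. i < n \<and> j < n \<and> i \<noteq> j}"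

definition complete_bipartite_graph :: "nat \<Rightarrow> nat \<Rightarrow> (nat + nat) sgraph" where
  "complete_bipartite_graph s t =
     SGraph ({..<s} <+> {..<t}) {{Inl i, Inr j} | i j. i < s \<and> j < t}"

definition connected_graph :: "'a sgraph \<Rightarrow> bool" where
  "connected_graph G \<longleftrightarrow> verts G \<noteq> {} \<and>
     (\<forall>u\<in>verts G. \<forall>v\<in>verts G. (u, v) \<in> {(x, y). {x, y} \<in> edges G}\<^sup>*)"

definition tree :: "'a sgraph \<Rightarrow> bool" where
  "tree T \<longleftrightarrow> simple_graph T \<and> connected_graph T \<and> (\<forall>n\<ge>3. free_of T (cycle_graph n))"

definition degree :: "'a sgraph \<Rightarrow> 'a \<Rightarrow> nat" where
  "degree G v = card {e \<in> edges G. v \<in> e}"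

definition leaf :: "'a sgraph \<Rightarrow> 'a \<Rightarrow> bool" where
  "leaf G v \<longleftrightarrow> v \<in> verts G \<and> degree G v = 1"

definition proper_edge_coloring :: "'a sgraph \<Rightarrow> ('a set \<Rightarrow> 'c) \<Rightarrow> bool" where
  "proper_edge_coloring G c \<longleftrightarrow>
     (\<forall>e\<in>edges G. \<forall>e'\<in>edges G. e \<noteq> e' \<and> e \<inter> e' \<noteq> {} \<longrightarrow> c e \<noteq> c e')"

definition rainbow :: "('a set \<Rightarrow> 'c) \<Rightarrow> 'a sgraph \<Rightarrow> bool" where
  "rainbow c S \<longleftrightarrow> inj_on c (edges S)"

text \<open>Natural numbers suffice as colors, the graphs being finite.\<close>

definition admits_rainbow_free_coloring :: "'a sgraph \<Rightarrow> 'b sgraph \<Rightarrow> bool" where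
  "admits_rainbow_free_coloring H F \<longleftrightarrow>
     (\<exists>c :: 'a set \<Rightarrow> nat. proper_edge_coloring H c \<and>
        \<not> (\<exists>S. subgraph S H \<and> isomorphic F S \<and> rainbow c S))"

text \<open>
  The maximum is over a finite set, which is nonempty as soon as \<open>F\<close> has an edge;
  see the two lemmas below.
\<close>

definition ex_star :: "'a sgraph \<Rightarrow> 'b sgraph \<Rightarrow> nat" where
  "ex_star G F =
     Max {card (edges H) | H. subgraph H G \<and> admits_rainbow_free_coloring H F}"

lemma finite_ex_star_set:
  assumes "simple_graph G"
  shows "finite {card (edges H) | H. subgraph H G \<and> admits_rainbow_free_coloring H F}"
proof -
  have "edges G \<subseteq> Pow (verts G)" "finite (verts G)"
    using assms by (auto simp: simple_graph_def)
  then have "finite (edges G)"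
    using finite_subset by blast
  then have "card (edges H) \<le> card (edges G)" if "subgraph H G" for H
    using that by (auto simp: subgraph_def intro: card_mono)
  then have "{card (edges H) | H. subgraph H G \<and> admits_rainbow_free_coloring H F}
      \<subseteq> {..card (edges G)}"
    by auto
  then show ?thesis
    using finite_subset by blast
qed

lemma ex_star_set_nonempty:
  assumes "simple_graph G" and "edges F \<noteq> {}"
  shows "{card (edges H) | H. subgraph H G \<and> admits_rainbow_free_coloring H F} \<noteq> {}"
proof -
  have "subgraph (SGraph (verts G) {}) G"
    using assms by (simp add: subgraph_def simple_graph_def)
  moreover have "admits_rainbow_free_coloring (SGraph (verts G) {}) F"
    using assms by (auto simp: admits_rainbow_free_coloring_def proper_edge_coloring_def
        subgraph_def isomorphic_def)
  ultimately show ?thesis by blast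
qed

end

theory Submission
  imports Defs
begin

text \<open>
  If \<open>e(H) > \<alpha> |V(H)|\<close>, then a minimal induced subgraph with this property has more than
  \<open>\<alpha> |S|\<close> edges touching every nonempty vertex set \<open>S\<close>. Given a proper edge coloring, a rainbow
  copy is found in this dense subgraph.

  (1) For \<open>\<alpha> = 2k - 2\<close> all degrees are at least \<open>2k - 1\<close>, and the tree is embedded greedily: at most
  \<open>k - 1\<close> vertices and \<open>k - 1\<close> colors are forbidden in each step.

  (2) For \<open>\<alpha> = 1\<close> some vertex \<open>v\<close> has degree at least 3, and all degrees are at least 2. A path
  \<open>v a b\<close> then extends backwards from \<open>v\<close> avoiding the color of \<open>ab\<close>.

  (3) For \<open>\<alpha> = 3/2\<close> some vertex \<open>v\<close> has degree at least 4, and no two vertices of degree 2 are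
  adjacent. The nonrainbow paths \<open>w v a b x\<close> force the vertices at distance 2 from \<open>v\<close> to have
  degree 2 and the neighbors of \<open>v\<close> to have degree 3. The nonrainbow paths \<open>b a v a' b'\<close> force two
  neighbors of \<open>v\<close> to share a vertex at distance 2, and \<open>v\<close> to have degree exactly 4. Now the ball
  of radius 2 around \<open>v\<close> is touched by too few edges.

  (4) For \<open>\<alpha> = (k - 1)/2\<close> all degrees are at least \<open>k/2\<close> and some \<open>v\<close> has degree at least \<open>k\<close>.
  Map \<open>x\<^sub>0\<close> to \<open>v\<close> and embed the tree without the leaves at \<open>x\<^sub>0\<close> first, placing vertices not
  adjacent to \<open>x\<^sub>0\<close> outside the neighborhood of \<open>v\<close>; this excludes at most \<open>r - 1\<close> further
  candidates. Then only the at most \<open>k - 1\<close> used colors obstruct the leaves at \<open>v\<close>.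
\<close>

section \<open>Neighborhoods, dense subgraphs and copies\<close>

definition neighbors :: "'a sgraph \<Rightarrow> 'a \<Rightarrow> 'a set" where
  "neighbors G v = {u. {v, u} \<in> edges G}"

definition has_rainbow_copy :: "'a sgraph \<Rightarrow> ('a set \<Rightarrow> 'c) \<Rightarrow> 'b sgraph \<Rightarrow> bool" where
  "has_rainbow_copy H c F \<longleftrightarrow> (\<exists>S. subgraph S H \<and> isomorphic F S \<and> rainbow c S)"

text \<open>The edges lost when the vertices of \<open>S\<close> are deleted, which is what the
  density condition counts.\<close>

definition touching :: "'a sgraph \<Rightarrow> 'a set \<Rightarrow> 'a set set" where
  "touching G S = {e \<in> edges G. e \<inter> S \<noteq> {}}"

lemma neighbors_sym: "u \<in> neighbors G v \<longleftrightarrow> v \<in> neighbors G u"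
  by (simp add: neighbors_def insert_commute)

lemma finite_edges: "simple_graph G \<Longrightarrow> finite (edges G)"
  by (rule finite_subset[of _ "Pow (verts G)"]) (auto simp: simple_graph_def)

lemma edge_ends:
  assumes "simple_graph G" "{u, v} \<in> edges G"
  shows "u \<in> verts G" "v \<in> verts G" "u \<noteq> v"
  using assms by (fastforce simp: simple_graph_def)+

lemma neighbors_subset: "simple_graph G \<Longrightarrow> neighbors G v \<subseteq> verts G"
  by (auto simp: neighbors_def dest: edge_ends)

lemma finite_neighbors: "simple_graph G \<Longrightarrow> finite (neighbors G v)"
  using neighbors_subset finite_subset by (metis simple_graph_def)

lemma incident_edges_eq:
  assumes "simple_graph G"
  shows "{e \<in> edges G. v \<in> e} = (\<lambda>u. {v, u}) ` neighbors G v"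
proof (intro equalityI subsetI)
  fix e assume e: "e \<in> {e \<in> edges G. v \<in> e}"
  then have "card e = 2" using assms by (auto simp: simple_graph_def)
  then obtain x y where "e = {x, y}" by (auto simp: card_2_iff)
  with e show "e \<in> (\<lambda>u. {v, u}) ` neighbors G v"
    by (auto simp: neighbors_def insert_commute)
qed (auto simp: neighbors_def)

lemma degree_eq_card_neighbors:
  assumes "simple_graph G"
  shows "degree G v = card (neighbors G v)"
proof -
  have "inj_on (\<lambda>u. {v, u}) (neighbors G v)"
    by (auto simp: inj_on_def doubleton_eq_iff)
  then show ?thesis
    by (simp add: degree_def incident_edges_eq[OF assms] card_image)
qed

lemma card_touching_singleton:
  "simple_graph G \<Longrightarrow> card (touching G {v}) = card (neighbors G v)"
  by (simp add: touching_def flip: degree_eq_card_neighbors) (simp add: degree_def)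

lemma touching_insert: "touching G (insert v S) = touching G {v} \<union> touching G S"
  by (auto simp: touching_def)

lemma finite_touching: "simple_graph G \<Longrightarrow> finite (touching G S)"
  by (simp add: touching_def finite_edges)

text \<open>Handshake lemma: vertex-edge incidences are counted twice, each edge having two
  ends.\<close>

lemma sum_card_neighbors:
  assumes "simple_graph G"
  shows "(\<Sum>v\<in>verts G. card (neighbors G v)) = 2 * card (edges G)"
proof -
  have "(\<Sum>v\<in>verts G. card {e \<in> edges G. v \<in> e}) = 2 * card (edges G)"
  proof (rule sum_multicount)
    show "\<forall>e\<in>edges G. card {v \<in> verts G. v \<in> e} = 2"
    proof
      fix e assume "e \<in> edges G"
      then have "{v \<in> verts G. v \<in> e} = e" "card e = 2"
        using assms by (auto simp: simple_graph_def)
      then show "card {v \<in> verts G. v \<in> e} = 2" by simp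
    qed
  qed (use assms finite_edges in \<open>auto simp: simple_graph_def\<close>)
  then show ?thesis
    by (simp flip: degree_def add: degree_eq_card_neighbors[OF assms])
qed

lemma exists_high_degree:
  assumes "simple_graph G" "real d * real (card (verts G)) < 2 * real (card (edges G))"
  obtains v where "v \<in> verts G" "d < card (neighbors G v)"
proof -
  have "\<not> (\<forall>v\<in>verts G. card (neighbors G v) \<le> d)"
  proof
    assume "\<forall>v\<in>verts G. card (neighbors G v) \<le> d"
    then have "(\<Sum>v\<in>verts G. card (neighbors G v)) \<le> card (verts G) * d"
      using sum_bounded_above[of "verts G" "\<lambda>v. card (neighbors G v)" d] by simp
    then have "2 * card (edges G) \<le> d * card (verts G)"
      by (simp add: sum_card_neighbors[OF assms(1)] mult.commute)
    then have "real (2 * card (edges G)) \<le> real (d * card (verts G))"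
      using of_nat_mono by blast
    then show False using assms(2) by simp
  qed
  then show thesis using that by force
qed

lemma subgraph_trans: "subgraph H G \<Longrightarrow> subgraph K H \<Longrightarrow> subgraph K G"
  by (auto simp: subgraph_def)

lemma free_of_subgraph: "free_of G F \<Longrightarrow> subgraph H G \<Longrightarrow> free_of H F"
  unfolding free_of_def using subgraph_trans by blast

lemma has_rainbow_copy_subgraph:
  "has_rainbow_copy K c F \<Longrightarrow> subgraph K H \<Longrightarrow> has_rainbow_copy H c F"
  unfolding has_rainbow_copy_def using subgraph_trans by blast

lemma proper_edge_coloring_subgraph:
  "proper_edge_coloring H c \<Longrightarrow> subgraph K H \<Longrightarrow> proper_edge_coloring K c"
  unfolding proper_edge_coloring_def subgraph_def by blast

text \<open>Repeatedly delete a set \<open>S\<close> touched by at most \<open>\<alpha> * card S\<close> edges.\<close>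

lemma dense_core:
  fixes \<alpha> :: real
  assumes "simple_graph G" "\<alpha> * real (card (verts G)) < real (card (edges G))"
  shows "\<exists>H. subgraph H G \<and> \<alpha> * real (card (verts H)) < real (card (edges H)) \<and>
    (\<forall>S\<subseteq>verts H. S \<noteq> {} \<longrightarrow> \<alpha> * real (card S) < real (card (touching H S)))"
  using assms
proof (induction "card (verts G)" arbitrary: G rule: less_induct)
  case less
  show ?case
  proof (cases "\<forall>S\<subseteq>verts G. S \<noteq> {} \<longrightarrow> \<alpha> * real (card S) < real (card (touching G S))")
    case True
    then show ?thesis using less.prems by (auto simp: subgraph_def)
  next
    case False
    then obtain S where S: "S \<subseteq> verts G" "S \<noteq> {}"
      "real (card (touching G S)) \<le> \<alpha> * real (card S)"
      by (auto simp: not_less)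
    \<comment> \<open>Deleting \<open>S\<close> lowers the left side by
      \<open>\<alpha> * card S\<close> and the number of edges by no more than that, so the strict
      inequality survives on fewer vertices.\<close>
    define K where "K = SGraph (verts G - S) (edges G - touching G S)"
    have fin: "finite (verts G)" using less.prems(1) by (simp add: simple_graph_def)
    have K: "subgraph K G"
      using less.prems(1) by (auto simp: K_def subgraph_def simple_graph_def touching_def)
    have finS: "finite S" using S(1) fin finite_subset by blast
    have cS: "card S \<le> card (verts G)" "card S > 0"
      using S fin finS by (auto simp: card_mono card_gt_0_iff)
    have v: "card (verts K) = card (verts G) - card S"
      using card_Diff_subset[OF finS S(1)] by (simp add: K_def)
    have e: "card (edges K) = card (edges G) - card (touching G S)"
      "card (touching G S) \<le> card (edges G)"
      using finite_edges[OF less.prems(1)]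
      by (auto simp: K_def touching_def card_Diff_subset card_mono)
    have "\<alpha> * real (card (verts K)) = \<alpha> * real (card (verts G)) - \<alpha> * real (card S)"
      using v cS by (simp add: algebra_simps)
    then have "\<alpha> * real (card (verts K)) < real (card (edges K))"
      using less.prems(2) S(3) e by simp
    moreover have "card (verts K) < card (verts G)" using v cS by simp
    ultimately obtain H where "subgraph H K" "\<alpha> * real (card (verts H)) < real (card (edges H))"
      "\<forall>S\<subseteq>verts H. S \<noteq> {} \<longrightarrow> \<alpha> * real (card S) < real (card (touching H S))"
      using less.hyps[of K] K by (auto simp: subgraph_def)
    then show ?thesis using subgraph_trans[OF K] by blast
  qed
qed

section \<open>Copies given by injective maps\<close>

text \<open>The copy carries the image edges alone and need not be induced. This serves both to
  produce copies and to refute \<open>free_of\<close>.\<close>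

lemma embedding_copy:
  assumes "simple_graph H" "finite (verts F)" "\<forall>e\<in>edges F. e \<subseteq> verts F"
    and "inj_on f (verts F)" "f ` verts F \<subseteq> verts H" "\<forall>e\<in>edges F. f ` e \<in> edges H"
  defines "S \<equiv> SGraph (f ` verts F) ((`) f ` edges F)"
  shows "subgraph S H" "isomorphic F S"
proof -
  show "subgraph S H"
    using assms by (auto simp: subgraph_def simple_graph_def)
  show "isomorphic F S"
    using assms by (auto simp: isomorphic_def bij_betw_def)
qed

lemma embedding_rainbow_copy:
  assumes "simple_graph H" "finite (verts F)" "\<forall>e\<in>edges F. e \<subseteq> verts F"
    and "inj_on f (verts F)" "f ` verts F \<subseteq> verts H" "\<forall>e\<in>edges F. f ` e \<in> edges H"
    and "inj_on (\<lambda>e. c (f ` e)) (edges F)"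
  shows "has_rainbow_copy H c F"
  unfolding has_rainbow_copy_def
proof (intro exI conjI)
  show "rainbow c (SGraph (f ` verts F) ((`) f ` edges F))"
    using assms(7) by (auto simp: rainbow_def inj_on_def)
qed (fact embedding_copy[OF assms(1-6)])+

lemma rainbow_path_copy:
  assumes "simple_graph H" "k > 0" "inj_on f {..k}" "\<And>i. i < k \<Longrightarrow> {f i, f (Suc i)} \<in> edges H"
    and "inj_on (\<lambda>i. c {f i, f (Suc i)}) {..<k}"
  shows "has_rainbow_copy H c (path_graph k)"
proof (rule embedding_rainbow_copy[OF assms(1)])
  show "f ` verts (path_graph k) \<subseteq> verts H"
  proof
    fix x assume "x \<in> f ` verts (path_graph k)"
    then obtain i where i: "i \<le> k" "x = f i" by (auto simp: path_graph_def)
    show "x \<in> verts H"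
    proof (cases "i < k")
      case True
      then show ?thesis using assms(4)[of i] i edge_ends[OF assms(1)] by blast
    next
      \<comment> \<open>The last vertex \<open>f k\<close> is the second end of edge number
        \<open>k - 1\<close>, which exists because \<open>k > 0\<close>.\<close>
      case False
      then show ?thesis
        using assms(2) assms(4)[of "k - 1"] i edge_ends[OF assms(1)] by fastforce
    qed
  qed
  show "inj_on (\<lambda>e. c (f ` e)) (edges (path_graph k))"
    using assms(5) by (auto simp: path_graph_def inj_on_def)
qed (use assms in \<open>auto simp: path_graph_def\<close>)

lemma rainbow_P3:
  assumes "simple_graph H" "distinct [x0, x1, x2, x3]"
    and "{x0, x1} \<in> edges H" "{x1, x2} \<in> edges H" "{x2, x3} \<in> edges H"
    and "distinct [c {x0, x1}, c {x1, x2}, c {x2, x3}]"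
  shows "has_rainbow_copy H c (path_graph 3)"
proof (rule rainbow_path_copy[where f = "\<lambda>i. [x0, x1, x2, x3] ! i"])
  show "inj_on (\<lambda>i. [x0, x1, x2, x3] ! i) {..3}"
    using assms(2) by (intro inj_on_nth) auto
  show "inj_on (\<lambda>i. c {[x0, x1, x2, x3] ! i, [x0, x1, x2, x3] ! Suc i}) {..<3}"
    using assms(6) by (auto simp: inj_on_def less_Suc_eq numeral_eq_Suc)
qed (use assms in \<open>auto simp: less_Suc_eq numeral_eq_Suc\<close>)

lemma rainbow_P4:
  assumes "simple_graph H" "distinct [x0, x1, x2, x3, x4]"
    and "{x0, x1} \<in> edges H" "{x1, x2} \<in> edges H" "{x2, x3} \<in> edges H" "{x3, x4} \<in> edges H"
    and "distinct [c {x0, x1}, c {x1, x2}, c {x2, x3}, c {x3, x4}]"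
  shows "has_rainbow_copy H c (path_graph 4)"
proof (rule rainbow_path_copy[where f = "\<lambda>i. [x0, x1, x2, x3, x4] ! i"])
  show "inj_on (\<lambda>i. [x0, x1, x2, x3, x4] ! i) {..4}"
    using assms(2) by (intro inj_on_nth) auto
  show "inj_on (\<lambda>i. c {[x0, x1, x2, x3, x4] ! i, [x0, x1, x2, x3, x4] ! Suc i}) {..<4}"
    using assms(7) by (auto simp: inj_on_def less_Suc_eq numeral_eq_Suc)
qed (use assms in \<open>auto simp: less_Suc_eq numeral_eq_Suc\<close>)

lemma triangle_free:
  assumes G: "simple_graph G" "free_of G (complete_graph 3)"
    and e: "{x, y} \<in> edges G" "{y, z} \<in> edges G" "{x, z} \<in> edges G"
  shows False
proof -
  let ?f = "\<lambda>i::nat. [x, y, z] ! i"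
  have v: "x \<in> verts G" "y \<in> verts G" "z \<in> verts G" and d: "distinct [x, y, z]"
    using e edge_ends[OF G(1)] by auto
  have "inj_on ?f (verts (complete_graph 3))"
    using d by (intro inj_on_nth) (auto simp: complete_graph_def)
  moreover have "\<forall>e\<in>edges (complete_graph 3). ?f ` e \<in> edges G"
    using e by (auto simp: complete_graph_def less_Suc_eq numeral_eq_Suc insert_commute)
  moreover have "?f ` verts (complete_graph 3) \<subseteq> verts G"
    using v by (auto simp: complete_graph_def less_Suc_eq numeral_eq_Suc)
  ultimately show False
    using embedding_copy[OF G(1), of "complete_graph 3" ?f] G(2)
    by (auto simp: free_of_def complete_graph_def)
qed

lemma K2r_free_common_neighbors:
  assumes G: "simple_graph G" "free_of G (complete_bipartite_graph 2 r)"
    and uv: "u \<noteq> v" "u \<in> verts G" "v \<in> verts G"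
  shows "card (neighbors G u \<inter> neighbors G v) < r"
proof (rule ccontr)
  let ?K = "complete_bipartite_graph 2 r" and ?C = "neighbors G u \<inter> neighbors G v"
  assume "\<not> card ?C < r"
  then obtain g where g: "inj_on g {..<r}" "g ` {..<r} \<subseteq> ?C"
    using card_le_inj[of "{..<r}" ?C] finite_neighbors[OF G(1)] by auto
  \<comment> \<open>The side of size 2 goes to \<open>u\<close> and \<open>v\<close>, the side of
    size \<open>r\<close> injectively into the common neighbors.\<close>
  define f where "f = case_sum (\<lambda>i::nat. if i = 0 then u else v) g"
  have gu: "g j \<noteq> u" "g j \<noteq> v" "{u, g j} \<in> edges G" "{v, g j} \<in> edges G" "g j \<in> verts G" if "j < r" for j
    using g(2) that edge_ends[OF G(1)] unfolding neighbors_def by blast+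
  have "inj_on f (verts ?K)"
    using g(1) gu(1,2) uv(1)
    by (auto simp: inj_on_def f_def complete_bipartite_graph_def Plus_def less_2_cases_iff) metis+
  moreover have "f ` verts ?K \<subseteq> verts G"
    using uv gu(5) by (auto simp: f_def complete_bipartite_graph_def Plus_def)
  moreover have "\<forall>e\<in>edges ?K. f ` e \<in> edges G"
    using gu(3,4) by (auto simp: f_def complete_bipartite_graph_def)
  moreover have "finite (verts ?K)" "\<forall>e\<in>edges ?K. e \<subseteq> verts ?K"
    by (auto simp: complete_bipartite_graph_def Plus_def)
  ultimately show False
    using embedding_copy[OF G(1), of ?K f] G(2) by (auto simp: free_of_def)
qed

section \<open>Growing and embedding trees\<close>

text \<open>A rooted tree given by a building order, each new vertex \<open>y\<close> hanging at one
  earlier vertex \<open>p\<close>. Greedy embeddings then become rule inductions.\<close>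

inductive grown :: "'b \<Rightarrow> 'b set \<Rightarrow> 'b set set \<Rightarrow> bool" for x0 where
  root: "grown x0 {x0} {}"
| grow: "grown x0 W F \<Longrightarrow> p \<in> W \<Longrightarrow> y \<notin> W \<Longrightarrow> grown x0 (insert y W) (insert {p, y} F)"

lemma grown_root: "grown x0 W F \<Longrightarrow> x0 \<in> W"
  by (induction rule: grown.induct) auto

lemma grown_finite: "grown x0 W F \<Longrightarrow> finite W \<and> finite F"
  by (induction rule: grown.induct) auto

lemma grown_edges: "grown x0 W F \<Longrightarrow> e \<in> F \<Longrightarrow> e \<subseteq> W"
  by (induction rule: grown.induct) auto

lemma grown_card: "grown x0 W F \<Longrightarrow> card W = Suc (card F)"
proof (induction rule: grown.induct)
  case (grow W F p y)
  then have "{p, y} \<notin> F" using grown_edges by fastforce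
  then show ?case using grow grown_finite[OF grow(1)] by simp
qed simp

text \<open>A path from the newest vertex \<open>y\<close> is \<open>y\<close> followed by a path
  from its parent; reversal gives paths ending in \<open>y\<close>. Distinct lists are used since
  they close up to cycles directly.\<close>

lemma grown_path:
  assumes "grown x0 W F" "p \<in> W" "q \<in> W"
  shows "\<exists>xs. xs \<noteq> [] \<and> distinct xs \<and> set xs \<subseteq> W \<and> hd xs = p \<and> last xs = q \<and>
    (\<forall>i. Suc i < length xs \<longrightarrow> {xs ! i, xs ! Suc i} \<in> F)"
  using assms
proof (induction arbitrary: p q rule: grown.induct)
  case root
  then show ?case by (intro exI[of _ "[x0]"]) auto
next
  case (grow W F p' y)
  have new: "\<exists>xs. xs \<noteq> [] \<and> distinct xs \<and> set xs \<subseteq> insert y W \<and> hd xs = y \<and> last xs = q \<and>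
    (\<forall>i. Suc i < length xs \<longrightarrow> {xs ! i, xs ! Suc i} \<in> insert {p', y} F)" if "q \<in> W" for q
  proof -
    obtain xs where xs: "xs \<noteq> []" "distinct xs" "set xs \<subseteq> W" "hd xs = p'" "last xs = q"
      "\<forall>i. Suc i < length xs \<longrightarrow> {xs ! i, xs ! Suc i} \<in> F"
      using grow.IH[OF grow.hyps(2) \<open>q \<in> W\<close>] by blast
    then have "{(y # xs) ! i, (y # xs) ! Suc i} \<in> insert {p', y} F" if "i < length xs" for i
      using that by (cases i) (auto simp: hd_conv_nth insert_commute)
    then show ?thesis
      using xs grow.hyps(3) by (intro exI[of _ "y # xs"]) auto
  qed
  consider "p \<in> W" "q \<in> W" | "p = y" "q = y" | "p = y" "q \<in> W" | "p \<in> W" "q = y"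
    using grow.prems by auto
  then show ?case
  proof cases
    case 1
    then show ?thesis using grow.IH[of p q] by blast
  next
    case 2
    then show ?thesis by (intro exI[of _ "[y]"]) auto
  next
    case 3
    then show ?thesis using new by blast
  next
    case 4
    obtain xs where xs: "xs \<noteq> []" "distinct xs" "set xs \<subseteq> insert y W" "hd xs = y" "last xs = p"
      "\<forall>i. Suc i < length xs \<longrightarrow> {xs ! i, xs ! Suc i} \<in> insert {p', y} F"
      using new[OF 4(1)] by blast
    have "{rev xs ! i, rev xs ! Suc i} \<in> insert {p', y} F" if i: "Suc i < length xs" for i
    proof -
      define j where "j = length xs - Suc (Suc i)"
      have "rev xs ! i = xs ! Suc j" "rev xs ! Suc i = xs ! j" "Suc j < length xs"
        using i by (auto simp: j_def rev_nth Suc_diff_Suc)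
      then show ?thesis using xs(6) by (simp add: insert_commute)
    qed
    then show ?thesis
      using xs 4 by (intro exI[of _ "rev xs"]) (auto simp: hd_rev last_rev)
  qed
qed

text \<open>With two attachments, the path from \<open>p\<close> to \<open>q\<close> inside
  \<open>W\<close> together with \<open>y\<close> would form a cycle in \<open>T\<close>.\<close>

lemma tree_unique_attachment:
  assumes T: "tree T" and g: "grown x0 W F" "F \<subseteq> edges T"
    and y: "y \<notin> W" and p: "p \<in> W" "{p, y} \<in> edges T" and q: "q \<in> W" "{q, y} \<in> edges T"
  shows "p = q"
proof (rule ccontr)
  assume "p \<noteq> q"
  have T': "simple_graph T" using T by (simp add: tree_def)
  obtain xs where xs: "xs \<noteq> []" "distinct xs" "set xs \<subseteq> W" "hd xs = p" "last xs = q"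
    and E: "\<And>i. Suc i < length xs \<Longrightarrow> {xs ! i, xs ! Suc i} \<in> F"
    using grown_path[OF g(1) p(1) q(1)] by blast
  define n where "n = length xs"
  define f where "f i = (xs @ [y]) ! i" for i
  \<comment> \<open>The ends of the path differ, so it has at least two vertices and the cycle has
    length \<open>Suc n \<ge> 3\<close>, as the definition of \<open>tree\<close> requires.\<close>
  have "n \<noteq> 1"
  proof
    assume "n = 1"
    then have "hd xs = last xs" unfolding n_def by (cases xs) auto
    with xs \<open>p \<noteq> q\<close> show False by simp
  qed
  moreover have "n \<noteq> 0" using xs(1) by (simp add: n_def)
  ultimately have n: "n \<ge> 2" by linarith
  have e: "{f i, f (Suc i mod Suc n)} \<in> edges T" if "i < Suc n" for i
  proof -
    consider "Suc i < n" | "Suc i = n" | "i = n" using \<open>i < Suc n\<close> by linarith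
    then show ?thesis
    proof cases
      case 1
      then show ?thesis using E[of i] g(2) by (auto simp: f_def nth_append n_def)
    next
      case 2
      then have "xs ! i = q" using xs by (metis diff_Suc_1 last_conv_nth n_def)
      then show ?thesis using 2 q(2) by (auto simp: f_def nth_append n_def)
    next
      case 3
      have "xs ! 0 = p" using xs by (simp add: hd_conv_nth)
      then show ?thesis using 3 p(2) xs(1) by (auto simp: f_def nth_append n_def insert_commute)
    qed
  qed
  let ?C = "cycle_graph (Suc n)"
  have "inj_on f (verts ?C)"
    unfolding f_def using xs y by (intro inj_on_nth) (auto simp: cycle_graph_def n_def)
  moreover have "f ` verts ?C \<subseteq> verts T"
    using e edge_ends(1)[OF T'] by (auto simp: cycle_graph_def)
  moreover have "\<forall>e\<in>edges ?C. f ` e \<in> edges T"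
    using e by (auto simp: cycle_graph_def)
  moreover have "finite (verts ?C)" "\<forall>e\<in>edges ?C. e \<subseteq> verts ?C"
    by (auto simp: cycle_graph_def)
  ultimately have "\<not> free_of T ?C"
    using embedding_copy[OF T', of ?C f] by (auto simp: free_of_def)
  then show False using T n by (auto simp: tree_def)
qed

lemma connected_graph_closed:
  assumes "connected_graph T" "x \<in> C" "x \<in> verts T"
    and closed: "\<And>p y. p \<in> C \<Longrightarrow> {p, y} \<in> edges T \<Longrightarrow> y \<in> C"
  shows "verts T \<subseteq> C"
proof
  fix z assume "z \<in> verts T"
  then have "(x, z) \<in> {(x, y). {x, y} \<in> edges T}\<^sup>*"
    using assms by (auto simp: connected_graph_def)
  then show "z \<in> C"
    by (induction rule: rtrancl_induct) (use assms(2) closed in auto)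
qed

text \<open>Because \<open>L\<close> consists of leaves hanging at \<open>x0\<close>, the rest of the tree can be grown first.\<close>

lemma tree_grown:
  assumes T: "tree T" and x0: "x0 \<in> verts T" "x0 \<notin> L"
    and L: "\<And>v u. v \<in> L \<Longrightarrow> {v, u} \<in> edges T \<Longrightarrow> u = x0"
  shows "grown x0 (verts T - L) {e \<in> edges T. e \<subseteq> verts T - L}"
proof -
  have T': "simple_graph T" "connected_graph T" "finite (verts T)"
    using T by (auto simp: tree_def simple_graph_def)
  let ?P = "\<lambda>W. W \<subseteq> verts T - L \<and> grown x0 W {e \<in> edges T. e \<subseteq> W}"
  have no_loop: "{e \<in> edges T. e \<subseteq> {x0}} = {}"
  proof (rule ccontr)
    assume "{e \<in> edges T. e \<subseteq> {x0}} \<noteq> {}"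
    then obtain e where "e \<in> edges T" "e \<subseteq> {x0}" by auto
    moreover from this have "card e = 2" using T' by (auto simp: simple_graph_def)
    ultimately show False using card_mono[of "{x0}" e] by simp
  qed
  have "?P {x0}" unfolding no_loop using x0 by (simp add: grown.root)
  moreover have "\<forall>W. ?P W \<longrightarrow> card W < Suc (card (verts T))"
    using T' by (auto simp: less_Suc_eq_le intro!: card_mono)
  \<comment> \<open>A grown induced set of maximum size is chosen; if it missed a vertex outside
    \<open>L\<close>, connectedness would allow one more attachment.\<close>
  ultimately have "\<exists>W. ?P W \<and> (\<forall>W'. ?P W' \<longrightarrow> card W' \<le> card W)"
    by (rule ex_has_greatest_nat)
  then obtain W where W: "?P W" and max: "\<And>W'. ?P W' \<Longrightarrow> card W' \<le> card W"
    by blast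
  have sub: "W \<subseteq> verts T - L" and gW: "grown x0 W {e \<in> edges T. e \<subseteq> W}"
    using W by auto
  have "W = verts T - L"
  proof (rule ccontr)
    assume "W \<noteq> verts T - L"
    then have nsub: "\<not> verts T \<subseteq> W \<union> L" using sub by blast
    have "x0 \<in> W" using gW by (rule grown_root)
    have "\<not> (\<forall>p\<in>W \<union> L. \<forall>y. {p, y} \<in> edges T \<longrightarrow> y \<in> W \<union> L)"
    proof
      assume "\<forall>p\<in>W \<union> L. \<forall>y. {p, y} \<in> edges T \<longrightarrow> y \<in> W \<union> L"
      then have "verts T \<subseteq> W \<union> L"
        using connected_graph_closed[OF T'(2) UnI1[OF \<open>x0 \<in> W\<close>] x0(1)] by metis
      then show False using nsub by contradiction
    qed
    then obtain p y where py: "p \<in> W \<union> L" "{p, y} \<in> edges T" "y \<notin> W \<union> L" by blast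
    \<comment> \<open>From a vertex of \<open>L\<close> an edge leads only to \<open>x0\<close>,
      which already lies in \<open>W\<close>.\<close>
    then have p: "p \<in> W" using L \<open>x0 \<in> W\<close> by blast
    have y: "y \<in> verts T - L" "y \<notin> W" using py edge_ends[OF T'(1)] by auto
    \<comment> \<open>Exactly one induced edge is gained, since \<open>y\<close> has no neighbor in
      \<open>W\<close> besides \<open>p\<close>.\<close>
    have "{e \<in> edges T. e \<subseteq> insert y W} = insert {p, y} {e \<in> edges T. e \<subseteq> W}"
    proof (intro equalityI subsetI)
      fix e assume e: "e \<in> {e \<in> edges T. e \<subseteq> insert y W}"
      show "e \<in> insert {p, y} {e \<in> edges T. e \<subseteq> W}"
      proof (cases "y \<in> e")
        case True
        then have "e \<in> (\<lambda>u. {y, u}) ` neighbors T y"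
          using e incident_edges_eq[OF T'(1), of y] by auto
        then obtain q where q: "e = {q, y}" "{q, y} \<in> edges T"
          by (auto simp: neighbors_def insert_commute)
        then have "q \<in> W" using e edge_ends(3)[OF T'(1)] by auto
        then have "p = q"
          using tree_unique_attachment[OF T gW _ y(2) p py(2) _ q(2)] by auto
        then show ?thesis using q by simp
      qed (use e in auto)
    qed (use p py in auto)
    then have "?P (insert y W)"
      using sub grown.grow[OF gW p y(2)] y by auto
    from max[OF this] have "card (insert y W) \<le> card W" .
    moreover have "finite W" using grown_finite[OF gW] by blast
    ultimately show False using y(2) by simp
  qed
  then show ?thesis using gW by simp
qed

section \<open>Greedy rainbow embeddings of grown trees\<close>

text \<open>Stated for a partial tree with vertices \<open>W\<close> and edges \<open>F\<close>, to
  serve as invariant along \<open>grown\<close>.\<close>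

definition rainbow_embedding ::
    "'a sgraph \<Rightarrow> ('a set \<Rightarrow> 'c) \<Rightarrow> 'b set \<Rightarrow> 'b set set \<Rightarrow> ('b \<Rightarrow> 'a) \<Rightarrow> bool" where
  "rainbow_embedding H c W F f \<longleftrightarrow> inj_on f W \<and> f ` W \<subseteq> verts H \<and>
     (\<forall>e\<in>F. f ` e \<in> edges H) \<and> inj_on (\<lambda>e. c (f ` e)) F"

lemma rainbow_embedding_root:
  "v \<in> verts H \<Longrightarrow> rainbow_embedding H c {x0} {} (\<lambda>_. v)"
  by (simp add: rainbow_embedding_def)

text \<open>Old edges lie inside \<open>W\<close>, so changing \<open>f\<close> at \<open>y\<close>
  leaves their images alone. The three conditions on \<open>u\<close> preserve edges, injectivity
  and distinct colors, in this order.\<close>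

lemma rainbow_embedding_extend:
  assumes H: "simple_graph H" and f: "rainbow_embedding H c W F f"
    and F: "\<And>e. e \<in> F \<Longrightarrow> e \<subseteq> W" and py: "p \<in> W" "y \<notin> W"
    and u: "u \<in> neighbors H (f p)" "u \<notin> f ` W" "c {f p, u} \<notin> (\<lambda>e. c (f ` e)) ` F"
  shows "rainbow_embedding H c (insert y W) (insert {p, y} F) (f(y := u))"
proof -
  let ?g = "f(y := u)"
  have W: "?g ` e = f ` e" if "e \<subseteq> W" for e
    using that py(2) by (intro image_cong) auto
  have F': "?g ` e = f ` e" if "e \<in> F" for e
    using W F that by blast
  have new: "?g ` {p, y} = {f p, u}" using py by auto
  have "inj_on ?g (insert y W)"
    using f u(2) py(2) W[of W] by (auto simp: rainbow_embedding_def inj_on_def)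
  moreover have "?g ` insert y W \<subseteq> verts H"
    using f u(1) neighbors_subset[OF H] W[of W] by (auto simp: rainbow_embedding_def)
  moreover have "\<forall>e\<in>insert {p, y} F. ?g ` e \<in> edges H"
    using f u(1) new F' by (auto simp: rainbow_embedding_def neighbors_def)
  moreover have "inj_on (\<lambda>e. c (?g ` e)) (insert {p, y} F)"
  proof -
    have "inj_on (\<lambda>e. c (?g ` e)) F"
      using f F' by (simp add: rainbow_embedding_def inj_on_def)
    moreover have "c (?g ` {p, y}) \<notin> (\<lambda>e. c (?g ` e)) ` F"
      using new u(3) F' by auto
    ultimately show ?thesis unfolding inj_on_insert by blast
  qed
  ultimately show ?thesis by (simp add: rainbow_embedding_def)
qed

lemma rainbow_embedding_copy:
  assumes "simple_graph H" "simple_graph T" "rainbow_embedding H c (verts T) (edges T) f"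
  shows "has_rainbow_copy H c T"
  using assms embedding_rainbow_copy[of H T f c]
  by (auto simp: rainbow_embedding_def simple_graph_def)

lemma inj_on_star_coloring:
  assumes "proper_edge_coloring H c"
  shows "inj_on (\<lambda>u. c {z, u}) (neighbors H z)"
proof (rule inj_onI)
  fix u w assume "u \<in> neighbors H z" "w \<in> neighbors H z" "c {z, u} = c {z, w}"
  then have "{z, u} = {z, w}"
    using assms by (fastforce simp: proper_edge_coloring_def neighbors_def)
  then show "u = w" by (auto simp: doubleton_eq_iff)
qed

text \<open>By properness each color occurs on at most one edge at \<open>z\<close>, so
  \<open>C\<close> excludes at most \<open>card C\<close> neighbors and \<open>X\<close> at most
  \<open>card X\<close>.\<close>

lemma neighbor_avoiding:
  assumes H: "simple_graph H" "proper_edge_coloring H c" and fin: "finite X" "finite C"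
    and less: "card X + card C < card (neighbors H z)"
  obtains u where "u \<in> neighbors H z" "u \<notin> X" "c {z, u} \<notin> C"
proof -
  let ?B = "{u \<in> neighbors H z. c {z, u} \<in> C}"
  have "card ?B = card ((\<lambda>u. c {z, u}) ` ?B)"
    by (rule card_image[symmetric], rule inj_on_subset[OF inj_on_star_coloring[OF H(2)]]) auto
  also have "\<dots> \<le> card C" using fin by (intro card_mono) auto
  finally have "card (X \<union> ?B) < card (neighbors H z)"
    using card_Un_le[of X ?B] less by linarith
  then have "\<not> neighbors H z \<subseteq> X \<union> ?B"
    using fin finite_neighbors[OF H(1)] card_mono[of "X \<union> ?B" "neighbors H z"] by auto
  then show thesis using that by blast
qed

lemma greedy_rainbow_embedding:
  assumes H: "simple_graph H" "proper_edge_coloring H c" and v: "v \<in> verts H"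
    and deg: "\<And>z. z \<in> verts H \<Longrightarrow> 2 * k - 1 \<le> card (neighbors H z)"
    and g: "grown x0 W F" "card F \<le> k"
  shows "\<exists>f. rainbow_embedding H c W F f"
  using g
proof (induction rule: grown.induct)
  case root
  show ?case by (intro exI) (rule rainbow_embedding_root[OF v])
next
  case (grow W F p y)
  have "{p, y} \<notin> F" using grow.hyps grown_edges by fastforce
  then have k: "card F < k" using grow.prems grown_finite[OF grow.hyps(1)] by simp
  obtain f where f: "rainbow_embedding H c W F f" using grow.IH k by auto
  have fin: "finite W" "finite F" using grown_finite[OF grow.hyps(1)] by auto
  \<comment> \<open>Of the \<open>card F + 1\<close> used vertices, \<open>f p\<close> is not its
    own neighbor. Hence \<open>card F\<close> vertices and at most \<open>card F\<close> colors are
    forbidden, together at most \<open>2 * k - 2\<close>.\<close>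
  have "card (f ` W - {f p}) + card ((\<lambda>e. c (f ` e)) ` F) < card (neighbors H (f p))"
  proof -
    have "card (f ` W) = Suc (card F)"
      using f grown_card[OF grow.hyps(1)] by (simp add: rainbow_embedding_def card_image)
    then have "card (f ` W - {f p}) = card F" using grow.hyps(2) fin by simp
    moreover have "card ((\<lambda>e. c (f ` e)) ` F) \<le> card F" using fin card_image_le by blast
    moreover have "2 * k - 1 \<le> card (neighbors H (f p))"
      using deg f grow.hyps(2) by (auto simp: rainbow_embedding_def)
    ultimately show ?thesis using k by linarith
  qed
  then obtain u where u: "u \<in> neighbors H (f p)" "u \<notin> f ` W - {f p}"
    "c {f p, u} \<notin> (\<lambda>e. c (f ` e)) ` F"
    using neighbor_avoiding[OF H, of "f ` W - {f p}" "(\<lambda>e. c (f ` e)) ` F" "f p"] fin by auto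
  then have "u \<noteq> f p" using edge_ends(3)[OF H(1)] by (auto simp: neighbors_def)
  then have "rainbow_embedding H c (insert y W) (insert {p, y} F) (f(y := u))"
    using rainbow_embedding_extend[OF H(1) f grown_edges[OF grow.hyps(1)] grow.hyps(2,3) u(1) _ u(3)] u(2)
    by blast
  then show ?case by blast
qed

text \<open>Requiring that an image vertex adjacent to the image of \<open>x0\<close> always comes from a neighbor of
  \<open>x0\<close> makes any edge of an unused color at the root lead to an unused vertex.\<close>

definition rooted_embedding ::
    "'a sgraph \<Rightarrow> ('a set \<Rightarrow> 'c) \<Rightarrow> 'b \<Rightarrow> 'a \<Rightarrow> 'b set \<Rightarrow> 'b set set \<Rightarrow> ('b \<Rightarrow> 'a) \<Rightarrow> bool" where
  "rooted_embedding H c x0 v W F f \<longleftrightarrow> rainbow_embedding H c W F f \<and> f x0 = v \<and>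
     (\<forall>w\<in>W. f w \<in> neighbors H v \<longrightarrow> {x0, w} \<in> F)"

text \<open>Only colors need to be avoided: a used vertex adjacent to \<open>v\<close> is the image
  of a neighbor of \<open>x0\<close>, so its edge to \<open>v\<close> has a used color.\<close>

lemma rooted_embedding_extend_at_root:
  assumes H: "simple_graph H" "proper_edge_coloring H c"
    and f: "rooted_embedding H c x0 v W F f" and g: "grown x0 W F" and y: "y \<notin> W"
    and less: "card F < card (neighbors H v)"
  shows "\<exists>f. rooted_embedding H c x0 v (insert y W) (insert {x0, y} F) f"
proof -
  have fin: "finite F" using grown_finite[OF g] by blast
  then have "card ((\<lambda>e. c (f ` e)) ` F) < card (neighbors H v)"
    using less card_image_le[of F "\<lambda>e. c (f ` e)"] by linarith
  then obtain u where u: "u \<in> neighbors H v" "c {v, u} \<notin> (\<lambda>e. c (f ` e)) ` F"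
    using neighbor_avoiding[OF H, of "{}" "(\<lambda>e. c (f ` e)) ` F" v] fin by auto
  have fv: "f x0 = v" and x0: "x0 \<in> W" using f grown_root[OF g] by (auto simp: rooted_embedding_def)
  have "u \<notin> f ` W"
  proof
    assume "u \<in> f ` W"
    then obtain w where "w \<in> W" "u = f w" by blast
    then have "{x0, w} \<in> F" "f ` {x0, w} = {v, u}" using f u(1) by (auto simp: rooted_embedding_def)
    then show False using u(2) by (metis imageI)
  qed
  then have "rainbow_embedding H c (insert y W) (insert {x0, y} F) (f(y := u))"
    using f u fv x0 y grown_edges[OF g]
    by (intro rainbow_embedding_extend[OF H(1)]) (auto simp: rooted_embedding_def)
  then have "rooted_embedding H c x0 v (insert y W) (insert {x0, y} F) (f(y := u))"
    using f x0 y by (auto simp: rooted_embedding_def)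
  then show ?thesis by blast
qed

text \<open>The new image also avoids the neighborhood of \<open>v\<close>, so the root condition is
  vacuous at \<open>y\<close>. The cost is the common neighbors of \<open>v\<close> and
  \<open>f p\<close>.\<close>

lemma rooted_embedding_extend_off_root:
  assumes H: "simple_graph H" "proper_edge_coloring H c"
    and f: "rooted_embedding H c x0 v W F f" and g: "grown x0 W F" and y: "y \<notin> W"
    and p: "p \<in> W" "p \<noteq> x0"
    and less: "2 * card F + card (neighbors H v \<inter> neighbors H (f p)) < card (neighbors H (f p))"
  shows "\<exists>f. rooted_embedding H c x0 v (insert y W) (insert {p, y} F) f"
proof -
  let ?C = "(\<lambda>e. c (f ` e)) ` F" and ?X = "f ` W - {f p} \<union> neighbors H v \<inter> neighbors H (f p)"
  have fin: "finite W" "finite F" using grown_finite[OF g] by auto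
  have fv: "f x0 = v" and x0: "x0 \<in> W" using f grown_root[OF g] by (auto simp: rooted_embedding_def)
  have "card (f ` W) = Suc (card F)"
    using f grown_card[OF g] by (simp add: rooted_embedding_def rainbow_embedding_def card_image)
  then have "card (f ` W - {f p}) = card F" using p fin by simp
  moreover have "card ?C \<le> card F" using fin card_image_le by blast
  ultimately have "card ?X + card ?C < card (neighbors H (f p))"
    using less card_Un_le[of "f ` W - {f p}" "neighbors H v \<inter> neighbors H (f p)"] by linarith
  then obtain u where u: "u \<in> neighbors H (f p)" "u \<notin> ?X" "c {f p, u} \<notin> ?C"
    using neighbor_avoiding[OF H, of ?X ?C "f p"] fin finite_neighbors[OF H(1)] by blast
  have "u \<noteq> f p" using u(1) edge_ends(3)[OF H(1)] by (auto simp: neighbors_def)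
  then have uW: "u \<notin> f ` W" and uv: "u \<notin> neighbors H v" using u by auto
  have "rainbow_embedding H c (insert y W) (insert {p, y} F) (f(y := u))"
    using f u uW p y grown_edges[OF g]
    by (intro rainbow_embedding_extend[OF H(1)]) (auto simp: rooted_embedding_def)
  then have "rooted_embedding H c x0 v (insert y W) (insert {p, y} F) (f(y := u))"
    using f fv x0 y uv by (auto simp: rooted_embedding_def)
  then show ?thesis by blast
qed

text \<open>Before the last step at most \<open>m - 1\<close> vertices, \<open>m - 1\<close> colors
  and \<open>r - 1\<close> common neighbors are excluded. The degree must exceed their sum
  \<open>2 * m + r - 3\<close>; the hypothesis says so without subtraction.\<close>

lemma greedy_rooted_embedding:
  assumes H: "simple_graph H" "proper_edge_coloring H c" and v: "v \<in> verts H"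
    and common: "\<And>z. z \<in> verts H \<Longrightarrow> z \<noteq> v \<Longrightarrow> card (neighbors H v \<inter> neighbors H z) < r"
    and deg: "\<And>z. z \<in> verts H \<Longrightarrow> 2 * m + r < card (neighbors H z) + 3"
    and degv: "m \<le> card (neighbors H v)"
    and g: "grown x0 W F" "card F \<le> m"
  shows "\<exists>f. rooted_embedding H c x0 v W F f"
  using g
proof (induction rule: grown.induct)
  case root
  have "v \<notin> neighbors H v" using edge_ends(3)[OF H(1), of v v] by (auto simp: neighbors_def)
  then have "rooted_embedding H c x0 v {x0} {} (\<lambda>_. v)"
    using rainbow_embedding_root[OF v] by (auto simp: rooted_embedding_def)
  then show ?case by blast
next
  case (grow W F p y)
  have "{p, y} \<notin> F" using grow.hyps grown_edges by fastforce
  then have m: "card F < m" using grow.prems grown_finite[OF grow.hyps(1)] by simp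
  obtain f where f: "rooted_embedding H c x0 v W F f" using grow.IH m by auto
  show ?case
  proof (cases "p = x0")
    case True
    then show ?thesis
      using rooted_embedding_extend_at_root[OF H f grow.hyps(1,3)] m degv by simp
  next
    case False
    have x0: "x0 \<in> W" using grown_root grow.hyps(1) .
    have "f p \<in> verts H" "f p \<noteq> v"
      using f grow.hyps(2) False x0
      by (auto simp: rooted_embedding_def rainbow_embedding_def inj_on_def)
    then have "card (neighbors H v \<inter> neighbors H (f p)) < r"
      "2 * m + r < card (neighbors H (f p)) + 3" using common deg by auto
    then have "2 * card F + card (neighbors H v \<inter> neighbors H (f p)) < card (neighbors H (f p))"
      using m by linarith
    then show ?thesis
      using rooted_embedding_extend_off_root[OF H f grow.hyps(1,3,2) False] by simp
  qed
qed

text \<open>All of \<open>L\<close> is attached at the root, where each step is obstructed by fewer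
  than \<open>card F + card L\<close> used colors.\<close>

lemma rooted_embedding_add_leaves:
  assumes H: "simple_graph H" "proper_edge_coloring H c"
    and g: "grown x0 W F" and f: "rooted_embedding H c x0 v W F f"
    and L: "finite L" "L \<inter> W = {}" "card F + card L \<le> card (neighbors H v)"
  shows "\<exists>f. grown x0 (W \<union> L) (F \<union> (\<lambda>y. {x0, y}) ` L) \<and>
    rooted_embedding H c x0 v (W \<union> L) (F \<union> (\<lambda>y. {x0, y}) ` L) f"
  using L
proof (induction L rule: finite_induct)
  case empty
  then show ?case using f g by auto
next
  case (insert y L)
  let ?W = "W \<union> L" and ?F = "F \<union> (\<lambda>y. {x0, y}) ` L"
  obtain f' where f': "grown x0 ?W ?F" "rooted_embedding H c x0 v ?W ?F f'"
    using insert by auto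
  have y: "y \<notin> ?W" using insert by auto
  have "card ?F \<le> card F + card L"
    using card_Un_le[of F "(\<lambda>y. {x0, y}) ` L"] card_image_le[OF insert.hyps(1), of "\<lambda>y. {x0, y}"]
    by linarith
  then have "card ?F < card (neighbors H v)" using insert by simp
  then obtain f'' where "rooted_embedding H c x0 v (insert y ?W) (insert {x0, y} ?F) f''"
    using rooted_embedding_extend_at_root[OF H f'(2,1) y] by blast
  moreover have "grown x0 (insert y ?W) (insert {x0, y} ?F)"
    using grown.grow[OF f'(1) _ y] grown_root[OF f'(1)] by blast
  ultimately show ?case by auto
qed

section \<open>From rainbow copies to \<open>ex_star\<close>\<close>

text \<open>The maximum over a finite nonempty set is attained by some subgraph with a rainbow-free
  coloring.\<close>

lemma ex_star_bound:
  assumes "simple_graph G" "edges F \<noteq> {}"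
    and "\<And>H c. subgraph H G \<Longrightarrow> proper_edge_coloring H (c :: _ \<Rightarrow> nat) \<Longrightarrow>
      \<not> has_rainbow_copy H c F \<Longrightarrow> P (card (edges H))"
  shows "P (ex_star G F)"
proof -
  have "ex_star G F \<in> {card (edges H) | H. subgraph H G \<and> admits_rainbow_free_coloring H F}"
    unfolding ex_star_def
    by (rule Max_in[OF finite_ex_star_set[OF assms(1)] ex_star_set_nonempty[OF assms(1,2)]])
  then show ?thesis
    using assms(3) by (auto simp: admits_rainbow_free_coloring_def has_rainbow_copy_def)
qed

text \<open>The common frame of the four bounds: a subgraph with too many edges contains a dense
  core, and a rainbow copy in the core is one in the subgraph. Nonnegativity of
  \<open>\<alpha>\<close> passes from \<open>verts H\<close> to \<open>verts G\<close>.\<close>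

lemma ex_star_le:
  fixes \<alpha> :: real
  assumes G: "simple_graph G" "edges F \<noteq> {}" "\<alpha> \<ge> 0"
    and core: "\<And>H c. subgraph H G \<Longrightarrow> proper_edge_coloring H (c :: _ \<Rightarrow> nat) \<Longrightarrow>
      \<alpha> * real (card (verts H)) < real (card (edges H)) \<Longrightarrow>
      (\<And>S. S \<subseteq> verts H \<Longrightarrow> S \<noteq> {} \<Longrightarrow> \<alpha> * real (card S) < real (card (touching H S))) \<Longrightarrow>
      has_rainbow_copy H c F"
  shows "real (ex_star G F) \<le> \<alpha> * real (card (verts G))"
proof (rule ex_star_bound[OF G(1,2)])
  fix H and c :: "'a set \<Rightarrow> nat"
  assume H: "subgraph H G" "proper_edge_coloring H c" "\<not> has_rainbow_copy H c F"
  have "card (verts H) \<le> card (verts G)"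
    using H(1) G(1) by (auto simp: subgraph_def simple_graph_def intro: card_mono)
  then have le: "\<alpha> * real (card (verts H)) \<le> \<alpha> * real (card (verts G))"
    using G(3) by (simp add: mult_left_mono)
  have "\<not> \<alpha> * real (card (verts H)) < real (card (edges H))"
  proof
    assume less: "\<alpha> * real (card (verts H)) < real (card (edges H))"
    have "simple_graph H" using H(1) by (simp add: subgraph_def)
    then obtain K where K: "subgraph K H" "\<alpha> * real (card (verts K)) < real (card (edges K))"
      "\<forall>S\<subseteq>verts K. S \<noteq> {} \<longrightarrow> \<alpha> * real (card S) < real (card (touching K S))"
      using dense_core[OF _ less] by blast
    have "has_rainbow_copy K c F"
      using core[of K c] K subgraph_trans[OF H(1)] proper_edge_coloring_subgraph[OF H(2)] by blast
    then show False using has_rainbow_copy_subgraph K(1) H(3) by blast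
  qed
  then show "real (card (edges H)) \<le> \<alpha> * real (card (verts G))" using le by linarith
qed

lemma core_min_degree:
  assumes "simple_graph H" "v \<in> verts H"
    and "\<And>S. S \<subseteq> verts H \<Longrightarrow> S \<noteq> {} \<Longrightarrow> \<alpha> * real (card S) < real (card (touching H S))"
  shows "\<alpha> < real (card (neighbors H v))"
  using assms(3)[of "{v}"] assms(2) by (simp add: card_touching_singleton[OF assms(1)])

text \<open>The constant \<open>2 * k - 2\<close> yields the strict bound with
  \<open>2 * k - 1\<close> once \<open>G\<close> has a vertex.\<close>

lemma ex_star_tree:
  assumes G: "simple_graph G" and T: "tree T" "card (edges T) = k" "k \<ge> 1"
  shows "real (ex_star G T) \<le> (2 * real k - 2) * real (card (verts G))"
proof (rule ex_star_le[OF G])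
  show "edges T \<noteq> {}" using T by auto
  show "2 * real k - 2 \<ge> 0" using T by simp
next
  fix H and c :: "'a set \<Rightarrow> nat"
  assume sub: "subgraph H G" and c: "proper_edge_coloring H c"
    and dense: "(2 * real k - 2) * real (card (verts H)) < real (card (edges H))"
    and core: "\<And>S. S \<subseteq> verts H \<Longrightarrow> S \<noteq> {} \<Longrightarrow>
      (2 * real k - 2) * real (card S) < real (card (touching H S))"
  have H: "simple_graph H" using sub by (simp add: subgraph_def)
  have T': "simple_graph T" using T by (simp add: tree_def)
  have "0 \<le> (2 * real k - 2) * real (card (verts H))" using T(3) by simp
  then have "edges H \<noteq> {}" using dense by auto
  then obtain v where v: "v \<in> verts H"
    using H by (fastforce simp: simple_graph_def card_2_iff)
  have deg: "2 * k - 1 \<le> card (neighbors H z)" if "z \<in> verts H" for z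
    using core_min_degree[OF H that core] T(3) by linarith
  obtain x0 where x0: "x0 \<in> verts T" using T(1) by (auto simp: tree_def connected_graph_def)
  have eq: "{e \<in> edges T. e \<subseteq> verts T - {}} = edges T"
    using T' by (auto simp: simple_graph_def)
  have "grown x0 (verts T) (edges T)"
    using tree_grown[OF T(1) x0, of "{}"] unfolding eq by simp
  then obtain f where "rainbow_embedding H c (verts T) (edges T) f"
    using greedy_rainbow_embedding[OF H c v deg, of x0 "verts T" "edges T"] T(2) by auto
  then show "has_rainbow_copy H c T" using rainbow_embedding_copy[OF H T'] by blast
qed

section \<open>Short paths\<close>

lemma path_graph_edges_nonempty: "k > 0 \<Longrightarrow> edges (path_graph k) \<noteq> {}"
  by (auto simp: path_graph_def)

lemma ex_star_P3:
  assumes G: "simple_graph G" "free_of G (complete_graph 3)"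
  shows "real (ex_star G (path_graph 3)) \<le> 1 * real (card (verts G))"
proof (rule ex_star_le[OF G(1)])
  show "edges (path_graph 3) \<noteq> {}" by (simp add: path_graph_edges_nonempty)
  show "(1::real) \<ge> 0" by simp
next
  fix H and c :: "'a set \<Rightarrow> nat"
  assume sub: "subgraph H G" and c: "proper_edge_coloring H c"
    and dense: "1 * real (card (verts H)) < real (card (edges H))"
    and core: "\<And>S. S \<subseteq> verts H \<Longrightarrow> S \<noteq> {} \<Longrightarrow> 1 * real (card S) < real (card (touching H S))"
  have H: "simple_graph H" using sub by (simp add: subgraph_def)
  have free: "free_of H (complete_graph 3)" using free_of_subgraph[OF G(2) sub] .
  obtain v where v: "v \<in> verts H" "2 < card (neighbors H v)"
    using exists_high_degree[OF H, of 2] dense by auto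
  then obtain a where a: "a \<in> neighbors H v" by fastforce
  have "1 < card (neighbors H a)"
    using core_min_degree[OF H _ core, of a] a neighbors_subset[OF H] by fastforce
  then obtain b where b: "b \<in> neighbors H a" "b \<notin> {v}"
    using neighbor_avoiding[OF H c, of "{v}" "{}" a] by auto
  \<comment> \<open>Among at least three neighbors of \<open>v\<close>, one is \<open>a\<close> and
    at most one is joined to \<open>v\<close> in the color of \<open>{a, b}\<close>. The path sought
    is \<open>w v a b\<close>.\<close>
  obtain w where w: "w \<in> neighbors H v" "w \<notin> {a}" "c {v, w} \<notin> {c {a, b}}"
    using neighbor_avoiding[OF H c, of "{a}" "{c {a, b}}" v] v(2) by auto
  have e: "{w, v} \<in> edges H" "{v, a} \<in> edges H" "{a, b} \<in> edges H"
    using a b w by (auto simp: neighbors_def insert_commute)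
  have "w \<noteq> b" using triangle_free[OF H free e(2,3)] w(1) by (auto simp: neighbors_def)
  moreover have "c {v, a} \<noteq> c {v, w}"
    using inj_on_star_coloring[OF c, of v] a w by (auto simp: inj_on_def)
  moreover have "c {a, v} \<noteq> c {a, b}"
    using inj_on_star_coloring[OF c, of a] a b by (auto simp: inj_on_def neighbors_sym[of v H a])
  ultimately show "has_rainbow_copy H c (path_graph 3)"
    using e w b edge_ends(3)[OF H] by (intro rainbow_P3[OF H _ e]) (auto simp: insert_commute)
qed

text \<open>A hypothetical minimal counterexample to part (3).\<close>

locale dense_P4_free =
  fixes H :: "'a sgraph" and c :: "'a set \<Rightarrow> 'c"
  assumes simple: "simple_graph H"
    and proper: "proper_edge_coloring H c"
    and triangle: "free_of H (complete_graph 3)"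
    and K23: "free_of H (complete_bipartite_graph 2 3)"
    and no_P4: "\<not> has_rainbow_copy H c (path_graph 4)"
    and dense: "S \<subseteq> verts H \<Longrightarrow> S \<noteq> {} \<Longrightarrow> 3 * card S < 2 * card (touching H S)"
begin

abbreviation N where "N \<equiv> neighbors H"

lemma N_sym: "u \<in> N v \<longleftrightarrow> v \<in> N u"
  by (rule neighbors_sym)

lemma N_irrefl: "v \<notin> N v"
  using edge_ends(3)[OF simple, of v v] by (auto simp: neighbors_def)

lemma N_verts: "u \<in> N v \<Longrightarrow> u \<in> verts H"
  using neighbors_subset[OF simple] by blast

lemma finite_N: "finite (N v)"
  by (rule finite_neighbors[OF simple])

lemma min_degree: "v \<in> verts H \<Longrightarrow> 2 \<le> card (N v)"
  using dense[of "{v}"] by (simp add: card_touching_singleton[OF simple])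

text \<open>Two adjacent vertices of degree 2 touch at most \<open>2 + 2 - 1 = 3\<close> edges, but
  \<open>dense\<close> demands more than 3.\<close>

lemma degree_two_independent:
  assumes "u \<in> N w" "card (N u) = 2"
  shows "card (N w) \<noteq> 2"
proof
  assume w: "card (N w) = 2"
  let ?A = "touching H {u}" and ?B = "touching H {w}"
  have "{u, w} \<in> ?A \<inter> ?B"
    using assms(1) by (auto simp: touching_def neighbors_def insert_commute)
  then have "1 \<le> card (?A \<inter> ?B)"
    using finite_touching[OF simple] by (metis One_nat_def Suc_leI card_gt_0_iff empty_iff finite_Int)
  then have "card (touching H {u, w}) \<le> 3"
    using card_Un_Int[of ?A ?B] w assms(2) finite_touching[OF simple]
    by (simp add: touching_insert[of H u "{w}"] card_touching_singleton[OF simple])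
  moreover have "u \<noteq> w" "{u, w} \<subseteq> verts H"
    using assms(1) N_irrefl N_verts[of u w] N_verts[of w u] N_sym[of u w] by auto
  ultimately show False using dense[of "{u, w}"] by simp
qed

lemma N_triangle: "a \<in> N v \<Longrightarrow> b \<in> N a \<Longrightarrow> b \<notin> N v"
  using triangle_free[OF simple triangle] by (auto simp: neighbors_def)

lemma color_eq_iff: "u \<in> N v \<Longrightarrow> w \<in> N v \<Longrightarrow> c {v, u} = c {v, w} \<longleftrightarrow> u = w"
  using inj_on_star_coloring[OF proper, of v] by (auto simp: inj_on_def)

lemma no_rainbow_P4:
  assumes "x1 \<in> N x0" "x2 \<in> N x1" "x3 \<in> N x2" "x4 \<in> N x3" "distinct [x0, x1, x2, x3, x4]"
  shows "\<not> distinct [c {x0, x1}, c {x1, x2}, c {x2, x3}, c {x3, x4}]"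
  using rainbow_P4[OF simple, of x0 x1 x2 x3 x4 c] no_P4 assms by (auto simp: neighbors_def)

lemma common_neighbors:
  assumes "u \<in> verts H" "v \<in> verts H" "u \<noteq> v" "A \<subseteq> N u" "A \<subseteq> N v"
  shows "card A \<le> 2"
proof -
  have "card A \<le> card (N u \<inter> N v)"
    using assms finite_N by (intro card_mono) auto
  then show ?thesis using K2r_free_common_neighbors[OF simple K23, of u v] assms by simp
qed

end

text \<open>A locale of its own, so that it can be interpreted again with a neighbor of
  \<open>v\<close> in the role of \<open>v\<close>.\<close>

locale big_star = dense_P4_free +
  fixes v :: 'a
  assumes v: "v \<in> verts H" "4 \<le> card (N v)"
begin

text \<open>The path \<open>w v a b x\<close> is not rainbow. Consecutive edges differ by properness
  and \<open>{b, x}\<close> differs from \<open>{v, a}\<close> by hypothesis, so the repeated color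
  is that of \<open>{v, w}\<close>.\<close>

lemma extension_colors:
  assumes "a \<in> N v" "b \<in> N a" "b \<noteq> v" "x \<in> N b" "x \<noteq> a" "c {b, x} \<noteq> c {v, a}"
    and "w \<in> N v" "w \<noteq> a" "w \<noteq> x"
  shows "c {v, w} = c {a, b} \<or> c {v, w} = c {b, x}"
proof -
  have b: "b \<notin> N v" using N_triangle assms by blast
  have "distinct [w, v, a, b, x]"
    using assms b N_irrefl N_sym by auto
  moreover have "v \<in> N w" using assms N_sym by blast
  ultimately have "\<not> distinct [c {w, v}, c {v, a}, c {a, b}, c {b, x}]"
    using no_rainbow_P4[of v w a b x] assms by blast
  moreover have "c {v, w} \<noteq> c {v, a}" using color_eq_iff assms by blast
  moreover have "c {a, v} \<noteq> c {a, b}" using color_eq_iff assms N_sym by blast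
  moreover have "c {b, a} \<noteq> c {b, x}" using color_eq_iff assms N_sym by blast
  ultimately show ?thesis using assms(6) by (auto simp: insert_commute)
qed

text \<open>Otherwise the edges from \<open>v\<close> to its neighbors other than \<open>a\<close>
  and \<open>x\<close>, at least three in number, would share the two colors allowed by
  \<open>extension_colors\<close>.\<close>

lemma extension_color:
  assumes "a \<in> N v" "b \<in> N a" "b \<noteq> v" "x \<in> N b" "x \<noteq> a"
    and "x \<notin> N v \<or> 5 \<le> card (N v)"
  shows "c {b, x} = c {v, a}"
proof (rule ccontr)
  assume neq: "c {b, x} \<noteq> c {v, a}"
  have "2 < card (N v - {a, x})"
  proof (cases "x \<in> N v")
    case True
    then show ?thesis using assms finite_N by (simp add: card_Diff_subset)
  next
    case False
    then have "N v - {a, x} = N v - {a}" by auto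
    then show ?thesis using v assms finite_N by simp
  qed
  moreover have "card (N v - {a, x}) \<le> card {c {a, b}, c {b, x}}"
  proof (rule card_inj_on_le)
    show "inj_on (\<lambda>w. c {v, w}) (N v - {a, x})"
      using inj_on_star_coloring[OF proper] inj_on_subset by blast
    show "(\<lambda>w. c {v, w}) ` (N v - {a, x}) \<subseteq> {c {a, b}, c {b, x}}"
      using extension_colors[OF assms(1-5) neq] by auto
  qed simp
  moreover have "card {c {a, b}, c {b, x}} \<le> 2" by (simp add: card_insert_if)
  ultimately show False by linarith
qed

text \<open>A third neighbor at \<open>b\<close> would allow some \<open>x \<noteq> a\<close> with
  \<open>{b, x}\<close> not colored like \<open>{v, a}\<close>, so \<open>x\<close> is adjacent to
  \<open>v\<close>. A further neighbor \<open>y\<close> of \<open>b\<close> gives three common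
  neighbors of \<open>b\<close> and \<open>v\<close> if it is adjacent to \<open>v\<close>;
  otherwise \<open>{b, y}\<close> has the colors of both \<open>{v, a}\<close> and
  \<open>{v, x}\<close>.\<close>

lemma second_neighbor_degree:
  assumes "a \<in> N v" "b \<in> N a" "b \<noteq> v"
  shows "card (N b) = 2"
proof (rule ccontr)
  assume "card (N b) \<noteq> 2"
  moreover have b: "b \<in> verts H" using assms N_verts by blast
  ultimately have "2 < card (N b)" using min_degree[of b] by simp
  then have "1 < card (N b - {a})" using assms N_sym finite_N by simp
  then obtain x where x: "x \<in> N b" "x \<noteq> a" "c {b, x} \<noteq> c {v, a}"
    using neighbor_avoiding[OF simple proper, of "{a}" "{c {v, a}}" b] \<open>2 < card (N b)\<close> by auto
  then have xv: "x \<in> N v" using extension_color assms by blast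
  obtain y where y: "y \<in> N b" "y \<notin> {a, x}"
    using neighbor_avoiding[OF simple proper, of "{a, x}" "{}" b] \<open>2 < card (N b)\<close> x(2) by auto
  show False
  proof (cases "y \<in> N v")
    case True
    have "card {a, x, y} \<le> 2"
      by (rule common_neighbors[of b v]) (use assms b v x xv y True N_sym in auto)
    then show False using x y by auto
  next
    case False
    have "c {b, y} = c {v, a}" using extension_color[of a b y] assms y False by blast
    moreover have "c {b, y} = c {v, x}"
      using extension_color[of x b y] assms y False x xv N_sym by blast
    ultimately show False using color_eq_iff[of a v x] assms xv x by simp
  qed
qed

lemma neighbor_degree_ge:
  assumes "a \<in> N v"
  shows "3 \<le> card (N a)"
proof -
  have a: "2 \<le> card (N a)" using min_degree N_verts[OF assms] by blast
  then obtain b where b: "b \<in> N a" "b \<notin> {v}"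
    using neighbor_avoiding[OF simple proper, of "{v}" "{}" a] by auto
  then have "card (N a) \<noteq> 2"
    using second_neighbor_degree[OF assms] degree_two_independent by auto
  then show ?thesis using a by simp
qed

text \<open>If \<open>a\<close> had degree at least 4, it could take the place of \<open>v\<close>, and \<open>second_neighbor_degree\<close>
  would force degree 2 on the other neighbors of \<open>v\<close>.\<close>

lemma neighbor_degree:
  assumes "a \<in> N v"
  shows "card (N a) = 3"
proof (rule ccontr)
  assume "card (N a) \<noteq> 3"
  then have "4 \<le> card (N a)" using neighbor_degree_ge[OF assms] by simp
  then interpret a: big_star H c a
    by unfold_locales (use N_verts[OF assms] in auto)
  obtain w where w: "w \<in> N v" "w \<notin> {a}"
    using neighbor_avoiding[OF simple proper, of "{a}" "{}" v] v(2) by auto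
  then have "card (N w) = 2" using a.second_neighbor_degree[of v w] assms N_sym by auto
  then show False using neighbor_degree_ge[OF w(1)] by simp
qed

text \<open>Otherwise \<open>g\<close> and \<open>b\<close> can be chosen so that the path
  \<open>b a v a' g\<close> is rainbow. Absence of a shared vertex gives
  \<open>b \<noteq> g\<close>, and degree 3 leaves room to avoid one vertex and one color.\<close>

lemma unshared_color:
  assumes a: "a \<in> N v" and a': "a' \<in> N v" "a' \<noteq> a" and unshared: "N a \<inter> N a' \<subseteq> {v}"
  shows "\<exists>b\<in>N a - {v}. c {a, b} = c {v, a'}"
proof (rule ccontr)
  assume none: "\<not> ?thesis"
  obtain g where g: "g \<in> N a'" "g \<noteq> v" "c {a', g} \<noteq> c {v, a}"
    using neighbor_avoiding[OF simple proper, of "{v}" "{c {v, a}}" a'] neighbor_degree[OF a'(1)]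
    by auto
  obtain b where b: "b \<in> N a" "b \<noteq> v" "c {a, b} \<noteq> c {a', g}"
    using neighbor_avoiding[OF simple proper, of "{v}" "{c {a', g}}" a] neighbor_degree[OF a]
    by auto
  have va: "v \<in> N a" "v \<in> N a'" "a \<in> N b" using a a' b N_sym by auto
  have "b \<notin> N v" "g \<notin> N v" using N_triangle a a' b g by blast+
  then have "distinct [b, a, v, a', g]"
    using a a' b g unshared N_irrefl by auto
  then have "\<not> distinct [c {b, a}, c {a, v}, c {v, a'}, c {a', g}]"
    using no_rainbow_P4[of a b v a' g] va a'(1) g(1) by blast
  moreover have "c {a, v} \<noteq> c {a, b}" using color_eq_iff va(1) b by blast
  moreover have "c {v, a} \<noteq> c {v, a'}" using color_eq_iff a a' by blast
  moreover have "c {a', v} \<noteq> c {a', g}" using color_eq_iff va(2) g by blast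
  moreover have "c {a, b} \<noteq> c {v, a'}" using none b by blast
  ultimately show False using b(3) g(3) by (auto simp: insert_commute)
qed

text \<open>The two edges from \<open>a\<close> away from \<open>v\<close> block two colors, so some
  \<open>a' \<noteq> a\<close> is joined to \<open>v\<close> in neither; by
  \<open>unshared_color\<close> it shares a vertex with \<open>a\<close>. If \<open>v\<close> had
  degree at least 5, \<open>extension_color\<close> along \<open>v a' b a\<close> would force a
  blocked color.\<close>

lemma shared_neighbor:
  assumes a: "a \<in> N v"
  obtains a' b where "a' \<in> N v" "a' \<noteq> a" "b \<in> N a" "b \<in> N a'" "b \<noteq> v" "card (N v) = 4"
proof -
  let ?C = "(\<lambda>b. c {a, b}) ` (N a - {v})"
  have "card (N a - {v}) = 2" using neighbor_degree[OF a] a N_sym finite_N by simp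
  then have "card ?C \<le> 2" using card_image_le[of "N a - {v}"] finite_N by fastforce
  then obtain a' where a': "a' \<in> N v" "a' \<notin> {a}" "c {v, a'} \<notin> ?C"
    using neighbor_avoiding[OF simple proper, of "{a}" ?C v] v(2) finite_N by auto
  have "\<not> N a \<inter> N a' \<subseteq> {v}"
  proof
    assume "N a \<inter> N a' \<subseteq> {v}"
    then obtain b where "b \<in> N a - {v}" "c {a, b} = c {v, a'}"
      using unshared_color[OF a, of a'] a' by blast
    then show False using a'(3) by (metis imageI)
  qed
  then obtain b where b: "b \<in> N a" "b \<in> N a'" "b \<noteq> v" by blast
  have "\<not> 5 \<le> card (N v)"
  proof
    assume "5 \<le> card (N v)"
    then have "c {b, a} = c {v, a'}"
      using extension_color[of a' b a] a a' b N_sym by blast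
    then have "c {v, a'} = c {a, b}" by (metis insert_commute)
    then show False using a'(3) b by blast
  qed
  then show thesis using that[of a' b] a' b v(2) by simp
qed

text \<open>The ball of radius 2 around \<open>v\<close> contradicts \<open>dense\<close>: with \<open>B\<close> the vertices at distance 2, it has
  \<open>5 + card B\<close> vertices, and at most \<open>4 + 2 * card B\<close> edges touch it since every edge at a neighbor
  of \<open>v\<close> ends in \<open>v\<close> or in \<open>B\<close>; the shared vertex \<open>b\<close> gives \<open>card B \<le> 7\<close>.\<close>

lemma impossible: False
proof -
  obtain a where a: "a \<in> N v" using v(2) by fastforce
  obtain a' b where a': "a' \<in> N v" "a' \<noteq> a" and b: "b \<in> N a" "b \<in> N a'" "b \<noteq> v"
    and four: "card (N v) = 4"
    using shared_neighbor[OF a] by metis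
  have outer: "card (N x - {v}) = 2" if "x \<in> N v" for x
    using neighbor_degree[OF that] that N_sym finite_N by simp
  define B where "B = (\<Union>x\<in>N v. N x - {v})"
  have finB: "finite B" using finite_N by (auto simp: B_def)
  have "card B \<le> 7"
  proof -
    let ?R = "\<Union>x\<in>N v - {a, a'}. N x - {v}"
    \<comment> \<open>The shared vertex \<open>b\<close> is already counted at \<open>a\<close>,
      which leaves \<open>2 + 1 + 2 * 2 = 7\<close>.\<close>
    have "B \<subseteq> (N a - {v}) \<union> (N a' - {v} - {b}) \<union> ?R"
      using b by (auto simp: B_def)
    then have "card B \<le> card ((N a - {v}) \<union> (N a' - {v} - {b}) \<union> ?R)"
      using finite_N by (intro card_mono) auto
    also have "\<dots> \<le> card (N a - {v}) + card (N a' - {v} - {b}) + card ?R"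
      by (meson add_mono card_Un_le le_trans order_refl)
    also have "card (N a - {v}) = 2" using outer[OF a] .
    also have "card (N a' - {v} - {b}) = 1" using outer[OF a'(1)] b finite_N by simp
    also have "card ?R \<le> (\<Sum>x\<in>N v - {a, a'}. card (N x - {v}))"
      using finite_N by (intro card_UN_le) auto
    also have "\<dots> = 4" using outer four a a' finite_N by (simp add: card_Diff_subset)
    finally show ?thesis by simp
  qed
  moreover have "7 < card B"
  proof -
    let ?S = "insert v (N v \<union> B)"
    have "touching H ?S \<subseteq> touching H {v} \<union> (\<Union>b\<in>B. touching H {b})"
    proof
      fix e assume e: "e \<in> touching H ?S"
      then obtain s where s: "s \<in> e" "e \<in> edges H" "s \<in> ?S" by (auto simp: touching_def)
      show "e \<in> touching H {v} \<union> (\<Union>b\<in>B. touching H {b})"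
      proof (cases "s \<in> N v")
        case True
        obtain u where "e = {s, u}" "u \<in> N s"
          using s incident_edges_eq[OF simple, of s] by auto
        then show ?thesis using s True by (auto simp: touching_def B_def)
      next
        case False
        then show ?thesis using s by (auto simp: touching_def)
      qed
    qed
    then have "card (touching H ?S) \<le> card (touching H {v} \<union> (\<Union>b\<in>B. touching H {b}))"
      using finB finite_touching[OF simple] by (intro card_mono) auto
    also have "\<dots> \<le> card (touching H {v}) + (\<Sum>b\<in>B. card (touching H {b}))"
      using card_Un_le card_UN_le[OF finB, of "\<lambda>b. touching H {b}"] by (meson add_left_mono le_trans)
    also have "card (touching H {v}) = 4" using four by (simp add: card_touching_singleton[OF simple])
    also have "(\<Sum>b\<in>B. card (touching H {b})) = (\<Sum>b\<in>B. 2)"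
      using second_neighbor_degree
      by (intro sum.cong) (auto simp: B_def card_touching_singleton[OF simple])
    finally have upper: "card (touching H ?S) \<le> 4 + 2 * card B" by simp
    have "N v \<inter> B = {}" using N_triangle by (auto simp: B_def)
    moreover have "v \<notin> N v \<union> B" using N_irrefl by (auto simp: B_def)
    ultimately have "card ?S = 5 + card B"
      using four finB finite_N by (simp add: card_Un_disjoint)
    moreover have "?S \<subseteq> verts H" using v(1) N_verts by (auto simp: B_def)
    ultimately have "3 * (5 + card B) < 2 * card (touching H ?S)"
      using dense[of ?S] by (metis insert_not_empty)
    \<comment> \<open>Altogether \<open>15 + 3 * card B < 8 + 4 * card B\<close>.\<close>
    also have "\<dots> \<le> 2 * (4 + 2 * card B)" using upper by simp
    finally show ?thesis by simp
  qed
  ultimately show False by simp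
qed

end

lemma ex_star_P4:
  assumes G: "simple_graph G" "free_of G (complete_graph 3)"
    "free_of G (complete_bipartite_graph 2 3)"
  shows "real (ex_star G (path_graph 4)) \<le> 3 / 2 * real (card (verts G))"
proof (rule ex_star_le[OF G(1)])
  show "edges (path_graph 4) \<noteq> {}" by (simp add: path_graph_edges_nonempty)
  show "(3 / 2 :: real) \<ge> 0" by simp
next
  fix H and c :: "'a set \<Rightarrow> nat"
  assume sub: "subgraph H G" and c: "proper_edge_coloring H c"
    and dense: "3 / 2 * real (card (verts H)) < real (card (edges H))"
    and core: "\<And>S. S \<subseteq> verts H \<Longrightarrow> S \<noteq> {} \<Longrightarrow> 3 / 2 * real (card S) < real (card (touching H S))"
  have H: "simple_graph H" using sub by (simp add: subgraph_def)
  show "has_rainbow_copy H c (path_graph 4)"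
  proof (rule ccontr)
    assume no: "\<not> has_rainbow_copy H c (path_graph 4)"
    obtain v where v: "v \<in> verts H" "3 < card (neighbors H v)"
      using exists_high_degree[OF H, of 3] dense by auto
    have "3 * card S < 2 * card (touching H S)" if "S \<subseteq> verts H" "S \<noteq> {}" for S
      using core[OF that] by linarith
    then interpret big_star H c v
      using H c no v free_of_subgraph[OF G(2) sub] free_of_subgraph[OF G(3) sub]
      by unfold_locales auto
    show False by (rule impossible)
  qed
qed

section \<open>Trees with many leaves at one vertex\<close>

lemma ex_star_K2r_free:
  fixes G :: "'a sgraph" and T :: "'b sgraph"
  assumes r: "r \<ge> 3" and T: "tree T" "card (edges T) = k" "x0 \<in> verts T"
    and l: "card {v. leaf T v \<and> {x0, v} \<in> edges T} = l" "real l > 3 / 4 * real k + (real r - 3) / 2"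
    and G: "simple_graph G" "free_of G (complete_bipartite_graph 2 r)"
  shows "real (ex_star G T) \<le> (real k - 1) / 2 * real (card (verts G))"
proof -
  define L where "L = {v. leaf T v \<and> {x0, v} \<in> edges T}"
  let ?F = "{e \<in> edges T. e \<subseteq> verts T - L}" and ?E = "(\<lambda>y. {x0, y}) ` L"
  have T': "simple_graph T" using T by (simp add: tree_def)
  have finL: "finite L" "L \<subseteq> verts T"
    using T' finite_subset[of L "verts T"] by (auto simp: L_def leaf_def simple_graph_def)
  have x0: "x0 \<notin> L" using edge_ends(3)[OF T', of x0 x0] by (auto simp: L_def)
  have only: "u = x0" if "w \<in> L" "{w, u} \<in> edges T" for w u
  proof -
    have "card (neighbors T w) = 1" "x0 \<in> neighbors T w" "u \<in> neighbors T w"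
      using that degree_eq_card_neighbors[OF T'] by (auto simp: L_def leaf_def neighbors_def insert_commute)
    then show ?thesis by (metis card_1_singletonE singletonD)
  qed
  have grown: "grown x0 (verts T - L) ?F" using tree_grown[OF T(1,3) x0 only] .
  \<comment> \<open>Every edge meeting \<open>L\<close> joins a leaf to \<open>x0\<close>, so
    \<open>card ?F = k - l\<close> edges remain for the first phase.\<close>
  have split: "edges T = ?F \<union> ?E"
  proof (intro equalityI subsetI)
    fix e assume e: "e \<in> edges T"
    show "e \<in> ?F \<union> ?E"
    proof (cases "e \<inter> L = {}")
      case True
      then show ?thesis using e T' by (auto simp: simple_graph_def)
    next
      case False
      then obtain w where w: "w \<in> e" "w \<in> L" by blast
      then obtain u where "e = {w, u}" "u \<in> neighbors T w"
        using e incident_edges_eq[OF T', of w] by auto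
      then have "e = {x0, w}" using only[OF w(2), of u] by (auto simp: neighbors_def)
      then show ?thesis using w(2) by blast
    qed
  qed (auto simp: L_def)
  have "inj_on (\<lambda>y. {x0, y}) L" by (auto simp: inj_on_def doubleton_eq_iff)
  then have "card ?E = l" using l(1) by (simp add: card_image L_def)
  moreover have "card (edges T) = card ?F + card ?E"
    using split finite_edges[OF T'] finL(1) card_Un_disjoint[of ?F ?E] by fastforce
  ultimately have k: "k = card ?F + l" using T(2) by simp
  \<comment> \<open>Since \<open>r \<ge> 3\<close>, the lower bound on \<open>l\<close> is
    nonnegative; thus \<open>l > 0\<close> and \<open>T\<close> has an edge.\<close>
  have "3 \<le> real r" "0 \<le> 3 / 4 * real k" using r by simp_all
  then have "0 < real l" using l(2) by argo
  then have k1: "k \<ge> 1" using k by simp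
  show ?thesis
  proof (rule ex_star_le[OF G(1)])
    show "edges T \<noteq> {}" using k1 T(2) by auto
    show "(real k - 1) / 2 \<ge> 0" using k1 by simp
  next
    fix H and c :: "'a set \<Rightarrow> nat"
    assume sub: "subgraph H G" and c: "proper_edge_coloring H c"
      and dense: "(real k - 1) / 2 * real (card (verts H)) < real (card (edges H))"
      and core: "\<And>S. S \<subseteq> verts H \<Longrightarrow> S \<noteq> {} \<Longrightarrow>
        (real k - 1) / 2 * real (card S) < real (card (touching H S))"
    have H: "simple_graph H" using sub by (simp add: subgraph_def)
    have "real (k - 1) * real (card (verts H)) < 2 * real (card (edges H))"
      using dense k1 by simp
    then obtain v where v: "v \<in> verts H" "k - 1 < card (neighbors H v)"
      using exists_high_degree[OF H] by blast
    have common: "card (neighbors H v \<inter> neighbors H z) < r" if "z \<in> verts H" "z \<noteq> v" for z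
      using K2r_free_common_neighbors[OF H free_of_subgraph[OF G(2) sub]] that v(1) by auto
    \<comment> \<open>Here the bound on \<open>l\<close> enters:
      \<open>2 * (k - l) + r < k / 2 + 3\<close>, while all degrees are at least
      \<open>k / 2\<close>.\<close>
    have deg: "2 * card ?F + r < card (neighbors H z) + 3" if "z \<in> verts H" for z
    proof -
      have "k \<le> 2 * card (neighbors H z)"
        using core_min_degree[OF H that core] by (simp add: field_simps)
      then have "real k \<le> 2 * real (card (neighbors H z))" by linarith
      moreover have "real (card ?F) = real k - real l" using k by simp
      ultimately have "2 * real (card ?F) + real r < real (card (neighbors H z)) + 3"
        using l(2) by argo
      then show ?thesis by linarith
    qed
    have "card ?F \<le> card (neighbors H v)" using k v(2) by linarith
    then obtain f where f: "rooted_embedding H c x0 v (verts T - L) ?F f"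
      using greedy_rooted_embedding[OF H c v(1) common deg _ grown order_refl] by blast
    \<comment> \<open>The left side is \<open>k\<close>, and \<open>v\<close> was chosen with degree
      above \<open>k - 1\<close>.\<close>
    have "card ?F + card L \<le> card (neighbors H v)" using k l(1) v(2) by (simp add: L_def)
    then obtain f where "rooted_embedding H c x0 v (verts T - L \<union> L) (?F \<union> ?E) f"
      using rooted_embedding_add_leaves[OF H c grown f finL(1)] by blast
    moreover have "verts T - L \<union> L = verts T" using finL(2) by blast
    ultimately have "rainbow_embedding H c (verts T) (edges T) f"
      using split by (simp add: rooted_embedding_def)
    then show "has_rainbow_copy H c T" using rainbow_embedding_copy[OF H T'] by blast
  qed
qed

theorem theorem4p1:
  shows "(\<forall>(G :: 'a sgraph) (T :: 'b sgraph) k.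
            simple_graph G \<and> verts G \<noteq> {} \<and> tree T \<and> card (edges T) = k \<and> k \<ge> 1 \<longrightarrow>
            real (ex_star G T) < (2 * real k - 1) * real (card (verts G)))
       \<and> (\<forall>G :: 'a sgraph.
            simple_graph G \<and> free_of G (complete_graph 3) \<longrightarrow>
            ex_star G (path_graph 3) \<le> card (verts G))
       \<and> (\<forall>G :: 'a sgraph.
            simple_graph G \<and> free_of G (complete_graph 3) \<and>
            free_of G (complete_bipartite_graph 2 3) \<longrightarrow>
            real (ex_star G (path_graph 4)) \<le> 3 / 2 * real (card (verts G)))
       \<and> (\<forall>(r :: nat) (T :: 'b sgraph) k x\<^sub>0 l (G :: 'a sgraph).
            r \<ge> 3 \<and> tree T \<and> card (edges T) = k \<and> x\<^sub>0 \<in> verts T \<and>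
            card {v. leaf T v \<and> {x\<^sub>0, v} \<in> edges T} = l \<and>
            real l > 3 / 4 * real k + (real r - 3) / 2 \<and>
            simple_graph G \<and> free_of G (complete_bipartite_graph 2 r) \<longrightarrow>
            real (ex_star G T) \<le> (real k - 1) / 2 * real (card (verts G)))"
proof (intro conjI allI impI; elim conjE)
  fix G :: "'a sgraph" and T :: "'b sgraph" and k
  assume G: "simple_graph G" "verts G \<noteq> {}" and T: "tree T" "card (edges T) = k" "k \<ge> 1"
  have "0 < card (verts G)" using G by (simp add: simple_graph_def card_gt_0_iff)
  then have "(2 * real k - 2) * real (card (verts G)) < (2 * real k - 1) * real (card (verts G))"
    by simp
  then show "real (ex_star G T) < (2 * real k - 1) * real (card (verts G))"
    using ex_star_tree[OF G(1) T] by linarith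
next
  fix G :: "'a sgraph"
  assume "simple_graph G" "free_of G (complete_graph 3)"
  then show "ex_star G (path_graph 3) \<le> card (verts G)"
    using ex_star_P3[of G] by simp
next
  fix G :: "'a sgraph"
  assume "simple_graph G" "free_of G (complete_graph 3)"
    "free_of G (complete_bipartite_graph 2 3)"
  then show "real (ex_star G (path_graph 4)) \<le> 3 / 2 * real (card (verts G))"
    by (rule ex_star_P4)
next
  fix r k l :: nat and T :: "'b sgraph" and x\<^sub>0 and G :: "'a sgraph"
  assume "r \<ge> 3" "tree T" "card (edges T) = k" "x\<^sub>0 \<in> verts T"
    "card {v. leaf T v \<and> {x\<^sub>0, v} \<in> edges T} = l"
    "real l > 3 / 4 * real k + (real r - 3) / 2"
    "simple_graph G" "free_of G (complete_bipartite_graph 2 r)"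
  then show "real (ex_star G T) \<le> (real k - 1) / 2 * real (card (verts G))"
    by (rule ex_star_K2r_free)
qed

end
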